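(* Let $n,m\geq 1$ and $0\leq d\leq n$ be integers, let $K\subset \mathbb{R}^{n-d}$ be compact, and let $E:=K\times\mathbb{R}^d$. Let $f\in C^{\infty}_{per,d}(E,\mathbb{R}^m)$ and let $\{\gamma_x\}_{x\in E}$, $\{\delta_x\}_{x\in E}$ be two well-adapted smooth families of loops valued in $\mathbb{R}^m$. For any positive integer $N$ and any $i\in \{1, \ldots, n\}$, define the function $F\in C^{\infty}_{per,d}(E,\mathbb{R}^m)$ by $$F(x) := f(x) + \frac{1}{N} \, \mathrm{Int} ( \gamma_x) ( Nx_i ) + \frac{1}{N^2} \, \mathrm{Int}^2 ( \delta_x) ( Nx_i ) \qquad \forall x =( x_1, \ldots, x_n ) \in E.$$ Then the following properties are satisfied (as $N\to+\infty$): (i) $\|F-f\|_{C^0} = O(1/N)$. (ii) For all $j \in \{1, \ldots,n \}$ with $j\neq i$, $\|\partial_{j}F-\partial_{j}f\|_{C^0} = O(1/N)$. (iii) For all $j,k \in \{1, \ldots,n \}$ with $j,k\neq i$, $\|\partial_{jk}^2F-\partial_{jk}^2f\|_{C^0} = O(1/N)$. Moreover, the following properties are satisfied for any $x\in E$, with $O(1/N)$ uniform with respect to $x\in E$: (iv) $\partial_iF(x)=\partial_if(x)+ \gamma_x(Nx_i) - \overline{\gamma_x} +O(1/N)$. (v) $\partial_i^2 F(x)=\partial_i^2 f(x)+ 2 \left( \partial_i \gamma_x(Nx_i) - \overline{(\partial_i \gamma_x)}\right) + N \dot{\gamma}_x(Nx_i) + \delta_x(Nx_i) - \overline{\delta_x}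 + O(1/N)$, where $\dot{\gamma}_x$ stands for the derivative of $\gamma_x$ with respect to the periodic parameter of the loop. (vi) For all $j \in \{1, \ldots,n \}$ with $j\neq i$, $\partial_{ij}^2 F(x)=\partial_{ij}^2 f(x)+ \partial_j \gamma_x(Nx_i) - \overline{(\partial_j \gamma_x)} + O(1/N)$.
   Context: For an integer $0\le d\le n$ and a set $K\subset\mathbb{R}^{n-d}$, $C^{\infty}_{per,d}(K\times\mathbb{R}^d,\mathbb{R}^m)$ is the set of smooth functions $f:K\times\mathbb{R}^d\to\mathbb{R}^m$ that are $\mathbb{Z}^d$-periodic in the last $d$ variables: $f(x_1,\ldots,x_{n-d},x_{n-d+1}+k_1,\ldots,x_n+k_d)=f(x_1,\ldots,x_n)$ for all $k\in\mathbb{Z}^d$. If $K$ is not open, smooth means that the function extends smoothly to an open neighborhood; here we fix smooth extensions of $f$, $\gamma$, $\delta$ (periodic in the same variables, defined for the $\mathbb{R}^{n-d}$-component in an open neighborhood of $K$), extend $F$ by the same formula, and partial derivatives at points of $E$ are those of these extensions. $\partial_j$, $\partial^2_{jk}$ are partial derivatives with respect to $x_j$ and $x_j,x_k$, and $\partial_j^2=\partial^2_{jj}$. A well-adapted smooth family of loops valued in $\mathbb{R}^m$ is a family of the form $\{\gamma_x:=\gamma(x,\cdot)\}_{x\in E}$ for some $\gamma\in C^{\infty}_{per,d+1}(K\times\mathbb{R}^{d+1},\mathbb{R}^m)$ (so $\gamma_x(t)$ is smooth in $(x,t)$, $\mathbb{Z}^d$-periodic in the last $d$ components of $x$, and $1$-periodic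 in $t\in\mathbb{R}$). $\partial_j\gamma_x(t)$ denotes the partial derivative of $\gamma(x,t)$ in $x_j$ at fixed $t$. For a smooth $1$-periodic loop $\gamma:\mathbb{R}\to\mathbb{R}^m$, $\overline{\gamma}:=\int_0^1\gamma(s)\,ds$ and $\mathrm{Int}(\gamma)(t):=\int_0^t(\gamma(s)-\overline{\gamma})\,ds$, which is again smooth and $1$-periodic; $\mathrm{Int}^2=\mathrm{Int}\circ\mathrm{Int}$. $\|\cdot\|_{C^0}$ is the supremum norm over $E$. *)

theory Defs
  imports "HOL-Analysis.Analysis"
begin

section \<open>Smooth maps and partial derivatives\<close>

text \<open>
  \<open>Ck_on k U f\<close> is meant for open \<open>U\<close>: \<open>f\<close> is continuous or, for positive \<open>k\<close>, differentiable on
  \<open>U\<close> with every directional derivative of class \<open>C\<^sup>k\<^sup>-\<^sup>1\<close>. In finite dimension this is the usual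
  notion of a \<open>C\<^sup>k\<close> map.
\<close>

primrec Ck_on ::
    "nat \<Rightarrow> 'a::euclidean_space set \<Rightarrow> ('a \<Rightarrow> 'b::euclidean_space) \<Rightarrow> bool" where
  "Ck_on 0 U f \<longleftrightarrow> continuous_on U f"
| "Ck_on (Suc k) U f \<longleftrightarrow>
     f differentiable_on U \<and> (\<forall>v. Ck_on k U (\<lambda>x. frechet_derivative f (at x) v))"

definition smooth_on :: "'a::euclidean_space set \<Rightarrow> ('a \<Rightarrow> 'b::euclidean_space) \<Rightarrow> bool" where
  "smooth_on U f \<longleftrightarrow> (\<forall>k. Ck_on k U f)"

definition partial ::
    "'n \<Rightarrow> (real ^ 'n \<Rightarrow> 'b::real_normed_vector) \<Rightarrow> real ^ 'n::finite \<Rightarrow> 'b" where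
  "partial j f x = vector_derivative (\<lambda>h. f (x + h *\<^sub>R axis j 1)) (at 0)"

definition partial2 ::
    "'n \<Rightarrow> 'n \<Rightarrow> (real ^ 'n \<Rightarrow> 'b::real_normed_vector) \<Rightarrow> real ^ 'n::finite \<Rightarrow> 'b" where
  "partial2 j k f = partial j (partial k f)"


section \<open>The splitting of the ambient space and periodic smooth maps\<close>

text \<open>
  The coordinates \<open>1, ..., n\<close> are the elements of a finite linearly ordered index type \<open>'n\<close>, with
  \<open>n = CARD('n)\<close>. The space \<open>\<real>\<^sup>n\<^sup>-\<^sup>d\<close> is identified with the subspace of \<open>\<real>\<^sup>n\<close> on which the last
  \<open>d\<close> coordinates vanish; this includes the cases \<open>d = 0\<close> and \<open>d = n\<close>.
\<close>

definition last_coords :: "nat \<Rightarrow> 'n::{finite,linorder} set" where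
  "last_coords d = {j. card {k. j \<le> k} \<le> d}"

definition first_space :: "nat \<Rightarrow> (real ^ 'n::{finite,linorder}) set" where
  "first_space d = {x. \<forall>j\<in>last_coords d. x $ j = 0}"

definition first_proj ::
    "nat \<Rightarrow> real ^ 'n::{finite,linorder} \<Rightarrow> real ^ 'n::{finite,linorder}" where
  "first_proj d x = (\<chi> j. if j \<in> last_coords d then 0 else x $ j)"

text \<open>For \<open>K \<subseteq> first_space d\<close>, this is \<open>K \<times> \<real>\<^sup>d\<close>.\<close>

definition cylinder ::
    "nat \<Rightarrow> (real ^ 'n::{finite,linorder}) set \<Rightarrow> (real ^ 'n::{finite,linorder}) set" where
  "cylinder d K = {x. first_proj d x \<in> K}"

definition int_periods :: "nat \<Rightarrow> (real ^ 'n::{finite,linorder}) set" where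
  "int_periods d = {k. (\<forall>j\<in>last_coords d. k $ j \<in> \<int>) \<and> (\<forall>j. j \<notin> last_coords d \<longrightarrow> k $ j = 0)}"

text \<open>
  \<open>f \<in> C_per d K\<close>: the total function \<open>f\<close> restricts on \<open>V \<times> \<real>\<^sup>d\<close>, for some open neighborhood
  \<open>V\<close> of \<open>K\<close> in \<open>\<real>\<^sup>n\<^sup>-\<^sup>d\<close>, to a smooth map that is \<open>\<int>\<^sup>d\<close>-periodic in the last \<open>d\<close> variables.
  So \<open>f\<close> is a map in \<open>C\<^sup>\<infinity>\<^sub>p\<^sub>e\<^sub>r\<^sub>,\<^sub>d(K \<times> \<real>\<^sup>d)\<close> together with a chosen smooth periodic extension, and the
  partial derivatives of \<open>f\<close> at points of \<open>K \<times> \<real>\<^sup>d\<close> are those of this extension. The values of \<open>f\<close>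
  outside \<open>V \<times> \<real>\<^sup>d\<close> are irrelevant.
\<close>

definition C_per ::
    "nat \<Rightarrow> (real ^ 'n::{finite,linorder}) set \<Rightarrow>
      (real ^ 'n::{finite,linorder} \<Rightarrow> real ^ 'm::finite) set" where
  "C_per d K =
    {f. \<exists>V. openin (top_of_set (first_space d)) V \<and> K \<subseteq> V \<and>
          smooth_on (cylinder d V) f \<and>
          (\<forall>x\<in>cylinder d V. \<forall>k\<in>int_periods d. f (x + k) = f x)}"


section \<open>Families of loops\<close>

text \<open>
  The analogue of \<^const>\<open>C_per\<close> for \<open>C\<^sup>\<infinity>\<^sub>p\<^sub>e\<^sub>r\<^sub>,\<^sub>d\<^sub>+\<^sub>1(K \<times> \<real>\<^sup>d\<^sup>+\<^sup>1)\<close>: the additional last periodic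
  variable \<open>t\<close> is the second component in \<open>\<real>\<^sup>n\<^sup>+\<^sup>1 = \<real>\<^sup>n \<times> \<real>\<close>, and maps are curried, so that
  \<open>\<gamma> x\<close> is the loop \<open>\<gamma>\<^sub>x\<close>.
\<close>

definition well_adapted_family ::
    "nat \<Rightarrow> (real ^ 'n::{finite,linorder}) set \<Rightarrow>
      (real ^ 'n::{finite,linorder} \<Rightarrow> real \<Rightarrow> real ^ 'm::finite) \<Rightarrow> bool"
    where
  "well_adapted_family d K \<gamma> \<longleftrightarrow>
    (\<exists>V. openin (top_of_set (first_space d)) V \<and> K \<subseteq> V \<and>
       smooth_on (cylinder d V \<times> (UNIV :: real set)) (\<lambda>(x, t). \<gamma> x t) \<and>
       (\<forall>x\<in>cylinder d V. \<forall>t. \<forall>k\<in>int_periods d. \<forall>l\<in>\<int>. \<gamma> (x + k) (t + l) = \<gamma> x t))"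

definition loop_avg :: "(real \<Rightarrow> real ^ 'm::finite) \<Rightarrow> real ^ 'm" where
  "loop_avg \<gamma> = (LBINT s=0..1. \<gamma> s)"

definition loop_Int :: "(real \<Rightarrow> real ^ 'm::finite) \<Rightarrow> real \<Rightarrow> real ^ 'm" where
  "loop_Int \<gamma> t = (LBINT s=0..ereal t. \<gamma> s - loop_avg \<gamma>)"


section \<open>Asymptotics\<close>

text \<open>
  The supremum norm takes values in \<^typ>\<open>ennreal\<close>, so that it is \<open>\<infinity>\<close> on unbounded functions and
  \<open>0\<close> for empty \<open>E\<close>.
\<close>

definition C0_norm :: "'a set \<Rightarrow> ('a \<Rightarrow> 'b::real_normed_vector) \<Rightarrow> ennreal" where
  "C0_norm E g = (SUP x\<in>E. ennreal (norm (g x)))"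

definition O_inv :: "(nat \<Rightarrow> ennreal) \<Rightarrow> bool" where
  "O_inv a \<longleftrightarrow> (\<exists>C::real. \<forall>\<^sub>F N in sequentially. a N \<le> ennreal (C / real N))"

definition O_inv_uniform :: "'a set \<Rightarrow> (nat \<Rightarrow> 'a \<Rightarrow> 'b::real_normed_vector) \<Rightarrow> bool" where
  "O_inv_uniform E R \<longleftrightarrow>
    (\<exists>C::real. \<forall>\<^sub>F N in sequentially. \<forall>x\<in>E. norm (R N x) \<le> C / real N)"

end

theory Submission
  imports Defs
begin

text \<open>
  With \<open>g = Int \<gamma>\<close> and \<open>h = Int\<^sup>2 \<delta>\<close>, regarded as functions of \<open>(x, t)\<close>, the map \<open>F\<close> is the sum of \<open>f\<close>,
  \<open>g/N\<close> and \<open>h/N\<^sup>2\<close> along \<open>t = N x\<^sub>i\<close>. Differentiating in \<open>x\<^sub>i\<close> acts as \<open>\<partial>\<^sub>i + N \<partial>\<^sub>t\<close>, whereas \<open>\<partial>\<^sub>t\<close> undoes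
  \<open>Int\<close> up to the mean and \<open>\<partial>\<^sub>j\<close> commutes with \<open>Int\<close>. Hence every claimed expansion holds exactly,
  with a remainder \<open>a/N + b/N\<^sup>2\<close> in which \<open>a\<close> and \<open>b\<close> are smooth periodic functions of \<open>(x, t)\<close> that do
  not depend on \<open>N\<close>. Such functions are bounded on \<open>E \<times> \<real>\<close>, since \<open>E \<times> \<real>\<close> is covered by the
  translates of a compact set by periods.
\<close>

section \<open>Calculus of smooth maps\<close>

text \<open>Putting the direction before the base point makes \<open>dir_deriv f v\<close> a map on
  the same space as \<open>f\<close>, so class, periodicity and further differentiation can be
  stated for it directly.\<close>

definition dir_deriv :: "('a::euclidean_space \<Rightarrow> 'b::euclidean_space) \<Rightarrow> 'a \<Rightarrow> 'a \<Rightarrow> 'b" where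
  "dir_deriv f v x = frechet_derivative f (at x) v"

lemma dir_deriv_eq:
  assumes "(f has_derivative f') (at x)"
  shows "dir_deriv f v x = f' v"
  using frechet_derivative_at[OF assms] by (simp add: dir_deriv_def)

lemma has_derivative_dir_deriv:
  assumes "f differentiable at x"
  shows "(f has_derivative (\<lambda>v. dir_deriv f v x)) (at x)"
  using assms unfolding dir_deriv_def frechet_derivative_works by simp

lemma Ck_on_Suc_dir_deriv:
  "Ck_on (Suc k) U f \<longleftrightarrow> f differentiable_on U \<and> (\<forall>v. Ck_on k U (dir_deriv f v))"
  by (simp add: dir_deriv_def[abs_def])

declare Ck_on.simps(2) [simp del]

text \<open>Openness is what makes this work: the derivative at a point of \<open>U\<close> sees
  only values in \<open>U\<close>, so \<open>f\<close> and \<open>g\<close> also share their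
  directional derivatives there and the induction proceeds.\<close>

lemma Ck_on_cong:
  assumes "open U" and "Ck_on k U f" and "\<And>x. x \<in> U \<Longrightarrow> f x = g x"
  shows "Ck_on k U g"
  using assms(2,3)
proof (induction k arbitrary: f g)
  case 0
  then show ?case by (simp cong: continuous_on_cong)
next
  case (Suc k)
  have d: "(f has_derivative (\<lambda>v. dir_deriv f v x)) (at x)" if "x \<in> U" for x
    using Suc.prems(1) that \<open>open U\<close>
    by (auto simp: Ck_on_Suc_dir_deriv differentiable_on_eq_differentiable_at
        intro: has_derivative_dir_deriv)
  have d': "(g has_derivative (\<lambda>v. dir_deriv f v x)) (at x)" if "x \<in> U" for x
    using has_derivative_transform_within_open[OF d[OF that] \<open>open U\<close> that] Suc.prems(2) by simp
  have "Ck_on k U (dir_deriv g v)" for v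
  proof (rule Suc.IH)
    show "Ck_on k U (dir_deriv f v)" using Suc.prems(1) by (simp add: Ck_on_Suc_dir_deriv)
    show "dir_deriv f v x = dir_deriv g v x" if "x \<in> U" for x
      using dir_deriv_eq[OF d'[OF that]] by simp
  qed
  moreover have "g differentiable_on U"
    using d' by (meson differentiable_at_imp_differentiable_on differentiable_def)
  ultimately show ?case by (simp add: Ck_on_Suc_dir_deriv)
qed

text \<open>Allows any explicit derivative in place of the chosen \<open>frechet_derivative\<close>.
  The closure properties below exhibit the derivative by a differentiation rule and apply the
  induction hypothesis to its ingredients.\<close>

lemma Ck_on_SucI:
  assumes "open U" and d: "\<And>x. x \<in> U \<Longrightarrow> (f has_derivative f' x) (at x)"
    and c: "\<And>v. Ck_on k U (\<lambda>x. f' x v)"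
  shows "Ck_on (Suc k) U f"
  unfolding Ck_on_Suc_dir_deriv
proof (intro conjI allI)
  show "f differentiable_on U"
    using d by (meson differentiable_at_imp_differentiable_on differentiable_def)
  show "Ck_on k U (dir_deriv f v)" for v
    by (rule Ck_on_cong[OF \<open>open U\<close> c]) (simp add: dir_deriv_eq[OF d])
qed

lemma Ck_on_SucD:
  assumes "open U" and "Ck_on (Suc k) U f"
  shows "x \<in> U \<Longrightarrow> (f has_derivative (\<lambda>v. dir_deriv f v x)) (at x)"
    and "Ck_on k U (dir_deriv f v)"
  using assms by (auto simp: Ck_on_Suc_dir_deriv differentiable_on_eq_differentiable_at
      intro: has_derivative_dir_deriv)

lemma Ck_on_Suc_imp:
  assumes "Ck_on (Suc k) U f"
  shows "Ck_on k U f"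
  using assms
  by (induction k arbitrary: f)
    (auto simp: Ck_on_Suc_dir_deriv differentiable_imp_continuous_on)

lemma Ck_on_mono:
  assumes "Ck_on l U f" and "k \<le> l"
  shows "Ck_on k U f"
  using assms(2,1) by (induction rule: dec_induct) (auto intro: Ck_on_Suc_imp)

lemma Ck_on_subset:
  assumes "Ck_on k U f" and "V \<subseteq> U"
  shows "Ck_on k V f"
  using assms
  by (induction k arbitrary: f)
    (auto simp: Ck_on_Suc_dir_deriv intro: continuous_on_subset differentiable_on_subset)

section \<open>Closure properties of maps of class C^k\<close>

lemma Ck_on_const:
  assumes "open U"
  shows "Ck_on k U (\<lambda>x. c)"
proof (induction k arbitrary: c)
  case (Suc k)
  show ?case by (rule Ck_on_SucI[OF assms, where f' = "\<lambda>_ _. 0"]) (auto intro: Suc)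
qed simp

lemma Ck_on_linear:
  assumes "open U" and "bounded_linear f"
  shows "Ck_on k U f"
proof (cases k)
  case 0
  then show ?thesis using assms(2) by (simp add: linear_continuous_on)
next
  case (Suc l)
  show ?thesis unfolding Suc
    by (rule Ck_on_SucI[OF assms(1), where f' = "\<lambda>_. f"])
      (auto intro: assms bounded_linear_imp_has_derivative Ck_on_const)
qed

lemma Ck_on_add:
  assumes "open U" and "Ck_on k U f" and "Ck_on k U g"
  shows "Ck_on k U (\<lambda>x. f x + g x)"
  using assms(2,3)
proof (induction k arbitrary: f g)
  case (Suc k)
  note f = Ck_on_SucD[OF \<open>open U\<close> Suc.prems(1)] and g = Ck_on_SucD[OF \<open>open U\<close> Suc.prems(2)]
  show ?case
    by (rule Ck_on_SucI[OF assms(1) has_derivative_add[OF f(1) g(1)]]) (auto intro: Suc.IH f g)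
qed (auto intro: continuous_intros)

lemma Ck_on_sum:
  assumes "open U" and "\<And>i. i \<in> I \<Longrightarrow> Ck_on k U (f i)"
  shows "Ck_on k U (\<lambda>x. \<Sum>i\<in>I. f i x)"
  using assms(2)
  by (induction I rule: infinite_finite_induct) (auto intro: Ck_on_const Ck_on_add assms(1))

text \<open>By the product rule the derivative is a sum of two values of \<open>p\<close>, each
  pairing one factor with a derivative of the other. Hence the induction runs over all pairs
  \<open>f\<close>, \<open>g\<close>, and the undifferentiated factor is lowered by one
  class.\<close>

lemma Ck_on_bilinear:
  assumes "open U" and "bounded_bilinear p" and "Ck_on k U f" and "Ck_on k U g"
  shows "Ck_on k U (\<lambda>x. p (f x) (g x))"
  using assms(3,4)
proof (induction k arbitrary: f g)
  case 0
  then show ?case using assms(2) by (auto intro: bounded_bilinear.continuous_on)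
next
  case (Suc k)
  note f = Ck_on_SucD[OF \<open>open U\<close> Suc.prems(1)] and g = Ck_on_SucD[OF \<open>open U\<close> Suc.prems(2)]
  show ?case
    by (rule Ck_on_SucI[OF assms(1) bounded_bilinear.FDERIV[OF assms(2) f(1) g(1)]])
      (auto intro!: Suc.IH Ck_on_add f g intro: Suc.prems assms(1) Ck_on_Suc_imp)
qed

lemmas Ck_on_scaleR = Ck_on_bilinear[OF _ bounded_bilinear_scaleR]
  and Ck_on_inner = Ck_on_bilinear[OF _ bounded_bilinear_inner]

lemma Ck_on_diff:
  assumes "open U" and "Ck_on k U f" and "Ck_on k U g"
  shows "Ck_on k U (\<lambda>x. f x - g x)"
  using Ck_on_add[OF assms(1,2) Ck_on_scaleR[OF assms(1) Ck_on_const[OF assms(1), of k "- 1"] assms(3)]]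
  by simp

lemma Ck_on_Pair:
  assumes "open U" and "Ck_on k U f" and "Ck_on k U g"
  shows "Ck_on k U (\<lambda>x. (f x, g x))"
  using assms(2,3)
proof (induction k arbitrary: f g)
  case (Suc k)
  note f = Ck_on_SucD[OF \<open>open U\<close> Suc.prems(1)] and g = Ck_on_SucD[OF \<open>open U\<close> Suc.prems(2)]
  show ?case
    by (rule Ck_on_SucI[OF assms(1) has_derivative_Pair[OF f(1) g(1)]]) (auto intro: Suc.IH f g)
qed (auto intro: continuous_intros)

text \<open>Prepares the chain rule, where \<open>f\<close> is differentiated in the direction
  \<open>dir_deriv g v x\<close>, which moves with \<open>x\<close>. The expansion leaves
  derivatives of \<open>f\<close> in fixed basis directions with scalar coefficients.\<close>

lemma dir_deriv_euclidean_sum: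
  assumes "f differentiable at x"
  shows "dir_deriv f v x = (\<Sum>b\<in>Basis. (v \<bullet> b) *\<^sub>R dir_deriv f b x)"
proof -
  interpret bounded_linear "\<lambda>v. dir_deriv f v x"
    using has_derivative_dir_deriv[OF assms] by (rule has_derivative_bounded_linear)
  have "dir_deriv f v x = dir_deriv f (\<Sum>b\<in>Basis. (v \<bullet> b) *\<^sub>R b) x"
    by (simp add: euclidean_representation)
  then show ?thesis by (simp only: sum scaleR)
qed

text \<open>The induction varies \<open>f\<close> only: the derivative of the composition is a sum
  of derivatives of \<open>f\<close> composed with the same \<open>g\<close>, weighted by components
  of the derivative of \<open>g\<close>.\<close>

lemma Ck_on_compose:
  assumes "open U" and "open W" and "\<And>x. x \<in> U \<Longrightarrow> g x \<in> W" and "Ck_on k W f" and "Ck_on k U g"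
  shows "Ck_on k U (\<lambda>x. f (g x))"
  using assms(4,5)
proof (induction k arbitrary: f)
  case 0
  then show ?case using assms(3) by (auto intro: continuous_on_compose2)
next
  case (Suc k)
  note f = Ck_on_SucD[OF \<open>open W\<close> Suc.prems(1)] and g = Ck_on_SucD[OF \<open>open U\<close> Suc.prems(2)]
  have "((\<lambda>x. f (g x)) has_derivative (\<lambda>v. dir_deriv f (dir_deriv g v x) (g x))) (at x)"
    if "x \<in> U" for x
    using has_derivative_compose[OF g(1)[OF that] f(1)[OF assms(3)[OF that]]] .
  moreover have "dir_deriv f (dir_deriv g v x) (g x)
      = (\<Sum>b\<in>Basis. (dir_deriv g v x \<bullet> b) *\<^sub>R dir_deriv f b (g x))" if "x \<in> U" for x v
    using f(1)[OF assms(3)[OF that]] by (intro dir_deriv_euclidean_sum) (auto simp: differentiable_def)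
  ultimately have "((\<lambda>x. f (g x)) has_derivative
      (\<lambda>v. \<Sum>b\<in>Basis. (dir_deriv g v x \<bullet> b) *\<^sub>R dir_deriv f b (g x))) (at x)" if "x \<in> U" for x
    using that by simp
  then show ?case
  proof (rule Ck_on_SucI[OF assms(1)])
    show "Ck_on k U (\<lambda>x. \<Sum>b\<in>Basis. (dir_deriv g v x \<bullet> b) *\<^sub>R dir_deriv f b (g x))" for v
      by (intro Ck_on_sum Ck_on_scaleR Ck_on_inner Suc.IH f(2) g(2) Ck_on_const assms(1)
          Ck_on_Suc_imp[OF Suc.prems(2)])
  qed
qed

section \<open>Integrals over [0, 1] depending on a parameter\<close>

lemma has_derivative_integral_param:
  fixes h :: "'a::euclidean_space \<times> real \<Rightarrow> 'b::euclidean_space"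
  assumes "open W" and h: "Ck_on (Suc 0) (W \<times> UNIV) h" and "w \<in> W"
  shows "((\<lambda>w. integral {0..1} (\<lambda>u. h (w, u))) has_derivative
      (\<lambda>v. integral {0..1} (\<lambda>u. dir_deriv h (v, 0) (w, u)))) (at w)"
proof -
  have op: "open (W \<times> (UNIV :: real set))" using assms(1) by (simp add: open_Times)
  note hD = Ck_on_SucD[OF op h]
  \<comment> \<open>The Leibniz rule is applied on a convex set, so \<open>W\<close> is replaced by
    a ball around \<open>w\<close>.\<close>
  obtain e where e: "e > 0" "ball w e \<subseteq> W" using assms(1,3) open_contains_ball by metis
  \<comment> \<open>The derivative in the parameter alone, hence the directions
    \<open>(v, 0)\<close>, packaged as a bounded linear map. Its joint continuity is checked one
    direction \<open>v\<close> at a time, which suffices in finite dimension.\<close>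
  define D where "D = (\<lambda>y u. Blinfun (\<lambda>v. dir_deriv h (v, 0) (y, u)))"
  have d: "((\<lambda>y. h (y, u)) has_derivative (\<lambda>v. dir_deriv h (v, 0) (y, u))) (at y)"
    if "y \<in> W" for y u
  proof -
    have "((\<lambda>y. (y, u)) has_derivative (\<lambda>v. (v, 0))) (at y)"
      by (auto intro!: derivative_eq_intros)
    from has_derivative_compose[OF this hD(1)] that show ?thesis by simp
  qed
  have D: "blinfun_apply (D y u) = (\<lambda>v. dir_deriv h (v, 0) (y, u))" if "y \<in> W" for y u
    unfolding D_def
    by (rule bounded_linear_Blinfun_apply) (rule has_derivative_bounded_linear[OF d[OF that]])
  have cont: "continuous_on (ball w e \<times> cbox 0 1) (\<lambda>(y, u). D y u)"
  proof (rule continuous_on_blinfun_componentwise)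
    fix v :: 'a
    have "continuous_on (ball w e \<times> cbox 0 1) (dir_deriv h (v, 0))"
      using hD(2)[of "(v, 0)"] e(2) by (auto intro: continuous_on_subset)
    then show "continuous_on (ball w e \<times> cbox 0 1) (\<lambda>z. blinfun_apply (case z of (y, u) \<Rightarrow> D y u) v)"
      by (rule continuous_on_eq) (use e(2) D in auto)
  qed
  have ch: "continuous_on (W \<times> UNIV) h" using Ck_on_Suc_imp[OF h] by simp
  have int: "(\<lambda>u. h (y, u)) integrable_on cbox 0 1" if "y \<in> W" for y
    by (rule integrable_continuous)
      (use that in \<open>auto intro!: continuous_on_compose2[OF ch] continuous_intros\<close>)
  have "((\<lambda>y. integral (cbox 0 1) (\<lambda>u. h (y, u))) has_derivative
      blinfun_apply (integral (cbox 0 1) (D w))) (at w within ball w e)"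
  proof (rule leibniz_rule[OF _ int cont])
    fix y u assume "y \<in> ball w e"
    then have "y \<in> W" using e(2) by auto
    show "((\<lambda>y. h (y, u)) has_derivative blinfun_apply (D y u)) (at y within ball w e)"
      unfolding D[OF \<open>y \<in> W\<close>] by (rule has_derivative_at_withinI[OF d[OF \<open>y \<in> W\<close>]])
  next
    show "y \<in> W" if "y \<in> ball w e" for y using that e(2) by blast
    show "w \<in> ball w e" using e(1) by simp
  qed (rule convex_ball)
  then have "((\<lambda>y. integral {0..1} (\<lambda>u. h (y, u))) has_derivative
      blinfun_apply (integral (cbox 0 1) (D w))) (at w)"
    using at_within_open[of w "ball w e"] e(1) by simp
  moreover have "continuous_on (cbox 0 1) (\<lambda>u. (\<lambda>(y, u). D y u) (w, u))"
    by (rule continuous_on_compose2[OF cont, where f = "\<lambda>u. (w, u)"])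
      (use e(1) in \<open>auto intro!: continuous_on_Pair continuous_on_const continuous_on_id\<close>)
  then have "D w integrable_on cbox 0 1" by (intro integrable_continuous) simp
  then have "blinfun_apply (integral (cbox 0 1) (D w))
      = (\<lambda>v. integral {0..1} (\<lambda>u. dir_deriv h (v, 0) (w, u)))"
    using D[OF assms(3)] by (simp add: blinfun_apply_integral fun_eq_iff)
  ultimately show ?thesis by simp
qed

text \<open>The derivative is again an integral of this form, with integrand
  \<open>dir_deriv h (v, 0)\<close>, so the induction is over all \<open>h\<close>.\<close>

lemma Ck_on_integral_param:
  fixes h :: "'a::euclidean_space \<times> real \<Rightarrow> 'b::euclidean_space"
  assumes "open W" and "Ck_on k (W \<times> UNIV) h"
  shows "Ck_on k W (\<lambda>w. integral {0..1} (\<lambda>u. h (w, u)))"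
  using assms(2)
proof (induction k arbitrary: h)
  case 0
  then have "continuous_on (W \<times> cbox 0 1) (\<lambda>(w, u). h (w, u))"
    by (auto intro: continuous_on_subset)
  from integral_continuous_on_param[OF this] show ?case by simp
next
  case (Suc k)
  have op: "open (W \<times> (UNIV :: real set))" using assms(1) by (simp add: open_Times)
  have "Ck_on (Suc 0) (W \<times> UNIV) h" using Suc.prems by (rule Ck_on_mono) simp
  from has_derivative_integral_param[OF assms(1) this] show ?case
    by (rule Ck_on_SucI[OF assms(1)]) (auto intro: Suc.IH Ck_on_SucD[OF op Suc.prems])
qed


section \<open>The same calculus for smooth maps\<close>

lemma dir_deriv_cong:
  assumes "open U" and "x \<in> U" and "f differentiable at x" and "\<And>y. y \<in> U \<Longrightarrow> f y = g y"
  shows "dir_deriv f v x = dir_deriv g v x"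
  using frechet_derivative_transform_within_open[OF assms(3,1,2,4)] by (simp add: dir_deriv_def)

lemma smooth_on_has_derivative:
  assumes "open U" and "smooth_on U f" and "x \<in> U"
  shows "(f has_derivative (\<lambda>v. dir_deriv f v x)) (at x)"
  using assms Ck_on_SucD(1)[of U 0] by (auto simp: smooth_on_def)

lemma smooth_on_differentiable:
  assumes "open U" and "smooth_on U f" and "x \<in> U"
  shows "f differentiable at x"
  using smooth_on_has_derivative[OF assms] by (auto simp: differentiable_def)

lemma smooth_on_imp_continuous_on: "smooth_on U f \<Longrightarrow> continuous_on U f"
  by (auto simp: smooth_on_def dest: spec[of _ 0])

lemma smooth_on_dir_deriv:
  assumes "open U" and "smooth_on U f"
  shows "smooth_on U (dir_deriv f v)"
  using assms Ck_on_SucD(2) unfolding smooth_on_def by blast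

lemma smooth_on_cong:
  assumes "open U" and "smooth_on U f" and "\<And>x. x \<in> U \<Longrightarrow> f x = g x"
  shows "smooth_on U g"
  using assms Ck_on_cong unfolding smooth_on_def by metis

lemma smooth_on_subset: "smooth_on U f \<Longrightarrow> V \<subseteq> U \<Longrightarrow> smooth_on V f"
  unfolding smooth_on_def using Ck_on_subset by blast

lemma smooth_on_linear: "open U \<Longrightarrow> bounded_linear f \<Longrightarrow> smooth_on U f"
  unfolding smooth_on_def using Ck_on_linear by blast

lemma smooth_on_add:
  "open U \<Longrightarrow> smooth_on U f \<Longrightarrow> smooth_on U g \<Longrightarrow> smooth_on U (\<lambda>x. f x + g x)"
  unfolding smooth_on_def using Ck_on_add by blast

lemma smooth_on_diff:
  "open U \<Longrightarrow> smooth_on U f \<Longrightarrow> smooth_on U g \<Longrightarrow> smooth_on U (\<lambda>x. f x - g x)"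
  unfolding smooth_on_def using Ck_on_diff by blast

lemma smooth_on_scaleR:
  "open U \<Longrightarrow> smooth_on U f \<Longrightarrow> smooth_on U g \<Longrightarrow> smooth_on U (\<lambda>x. f x *\<^sub>R g x)"
  unfolding smooth_on_def using Ck_on_scaleR by blast

lemma smooth_on_const: "open U \<Longrightarrow> smooth_on U (\<lambda>x. c)"
  unfolding smooth_on_def using Ck_on_const by blast

lemma smooth_on_Pair:
  "open U \<Longrightarrow> smooth_on U f \<Longrightarrow> smooth_on U g \<Longrightarrow> smooth_on U (\<lambda>x. (f x, g x))"
  unfolding smooth_on_def using Ck_on_Pair by blast

lemma smooth_on_compose:
  assumes "smooth_on W f" and "open W" and "open U" and "smooth_on U g"
    and "\<And>x. x \<in> U \<Longrightarrow> g x \<in> W"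
  shows "smooth_on U (\<lambda>x. f (g x))"
  using assms Ck_on_compose unfolding smooth_on_def by metis

lemma smooth_on_integral_param:
  fixes h :: "'a::euclidean_space \<times> real \<Rightarrow> 'b::euclidean_space"
  assumes "open W" and "smooth_on (W \<times> UNIV) h"
  shows "smooth_on W (\<lambda>w. integral {0..1} (\<lambda>u. h (w, u)))"
  using assms Ck_on_integral_param unfolding smooth_on_def by blast

lemma dir_deriv_add:
  assumes "f differentiable at x"
  shows "dir_deriv f (v + w) x = dir_deriv f v x + dir_deriv f w x"
    and "dir_deriv f (c *\<^sub>R v) x = c *\<^sub>R dir_deriv f v x"
proof -
  interpret bounded_linear "\<lambda>v. dir_deriv f v x"
    using has_derivative_dir_deriv[OF assms] by (rule has_derivative_bounded_linear)
  show "dir_deriv f (v + w) x = dir_deriv f v x + dir_deriv f w x"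
    and "dir_deriv f (c *\<^sub>R v) x = c *\<^sub>R dir_deriv f v x"
    by (rule add scaleR)+
qed


section \<open>Primitives of loops\<close>

lemma loop_avg_eq_integral:
  assumes "continuous_on UNIV \<eta>"
  shows "loop_avg \<eta> = integral {0..1} \<eta>"
  unfolding loop_avg_def zero_ereal_def one_ereal_def
  by (rule interval_integral_eq_integral)
    (auto intro!: borel_integrable_atLeastAtMost' continuous_on_subset[OF assms])

lemma loop_Int_has_vector_derivative:
  assumes "continuous_on UNIV \<eta>"
  shows "(loop_Int \<eta> has_vector_derivative \<eta> t - loop_avg \<eta>) (at t)"
proof -
  \<comment> \<open>The interval must contain the base point 0 of the primitive, and have
    \<open>t\<close> in its interior so that the one-variable derivative within it is the full
    derivative.\<close>
  define a b where "a = min t 0 - 1" and "b = max t 0 + 1"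
  have "(loop_Int \<eta> has_vector_derivative \<eta> t - loop_avg \<eta>) (at t within {a..b})"
    unfolding loop_Int_def[abs_def] zero_ereal_def
    by (rule interval_integral_FTC2)
      (auto simp: a_def b_def intro!: continuous_intros continuous_on_subset[OF assms])
  moreover have "at t within {a..b} = at t"
    by (rule at_within_interior) (auto simp: a_def b_def)
  ultimately show ?thesis by simp
qed

lemma loop_Int_0 [simp]: "loop_Int \<eta> 0 = 0"
  by (simp add: loop_Int_def flip: zero_ereal_def)

text \<open>
  The rescaling to the fixed interval \<open>[0, 1]\<close> makes the primitive an integral with parameter \<open>t\<close>,
  which is smooth in \<open>(x, t)\<close> for either sign of \<open>t\<close>.
\<close>

lemma loop_Int_eq_scaleR:
  assumes "continuous_on UNIV \<eta>"
  shows "loop_Int \<eta> t = t *\<^sub>R integral {0..1} (\<lambda>u. \<eta> (u * t) - loop_avg \<eta>)"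
proof -
  have "((\<lambda>u. loop_Int \<eta> (u * t)) has_vector_derivative t *\<^sub>R (\<eta> (u * t) - loop_avg \<eta>))
      (at u within {0..1})" for u
  proof -
    have "((\<lambda>u. u * t) has_vector_derivative t) (at u within {0..1})"
      by (auto intro!: derivative_eq_intros)
    from vector_diff_chain_within[OF this has_vector_derivative_at_within[OF
          loop_Int_has_vector_derivative[OF assms]]]
    show ?thesis by (simp add: o_def)
  qed
  then have "((\<lambda>u. t *\<^sub>R (\<eta> (u * t) - loop_avg \<eta>)) has_integral
      loop_Int \<eta> (1 * t) - loop_Int \<eta> (0 * t)) {0..1}"
    by (intro fundamental_theorem_of_calculus) auto
  from integral_unique[OF this] show ?thesis by simp
qed

lemma loop_Int_1:
  assumes "continuous_on UNIV \<eta>"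
  shows "loop_Int \<eta> 1 = 0"
proof -
  have "\<eta> integrable_on {0..1}"
    by (intro integrable_continuous_interval continuous_on_subset[OF assms]) auto
  then show ?thesis
    using integral_diff[of \<eta> "{0..1}" "\<lambda>_. loop_avg \<eta>"]
    by (simp add: loop_Int_eq_scaleR[OF assms] loop_avg_eq_integral[OF assms] integrable_const_ivl)
qed

text \<open>By periodicity of the loop, the increment of the primitive over one period has zero
  derivative. So it is constant, and it vanishes at 0 because the mean was subtracted
  (\<open>loop_Int_1\<close>). Period 1 then gives all integer shifts, negative ones
  included.\<close>

lemma loop_Int_periodic:
  assumes "continuous_on UNIV \<eta>" and per: "\<And>t. \<eta> (t + 1) = \<eta> t" and "l \<in> \<int>"
  shows "loop_Int \<eta> (t + l) = loop_Int \<eta> t"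
proof -
  note D = loop_Int_has_vector_derivative[OF assms(1)]
  have "((\<lambda>t. loop_Int \<eta> (t + 1) - loop_Int \<eta> t) has_derivative (\<lambda>_. 0)) (at t within UNIV)" for t
  proof -
    have "((\<lambda>t. loop_Int \<eta> (t + 1)) has_vector_derivative \<eta> t - loop_avg \<eta>) (at t)"
      using vector_diff_chain_at[of "\<lambda>t. t + 1" 1 t "loop_Int \<eta>", OF _ D]
      by (simp add: o_def per has_vector_derivative_add_const)
    from has_vector_derivative_diff[OF this D] show ?thesis
      by (simp add: has_vector_derivative_def)
  qed
  then obtain c where c: "loop_Int \<eta> (t + 1) - loop_Int \<eta> t = c" for t
    using has_derivative_zero_constant[of UNIV "\<lambda>t. loop_Int \<eta> (t + 1) - loop_Int \<eta> t"] by auto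
  from c[of 0] have "c = 0" by (simp add: loop_Int_1[OF assms(1)])
  with c interpret periodic_fun_simple' "loop_Int \<eta>" by unfold_locales (simp add: algebra_simps)
  from \<open>l \<in> \<int>\<close> show ?thesis by (auto elim!: Ints_cases simp: plus_of_int)
qed


section \<open>Periodic smooth families\<close>

text \<open>The set \<open>P\<close> consists of the periods in \<open>x\<close>; the variable \<open>t\<close> in \<open>(x, t)\<close> has the periods \<open>\<int>\<close>.\<close>

locale periodic_domain =
  fixes U P :: "'a::euclidean_space set"
  assumes open_U: "open U" and zero_P: "0 \<in> P"
    and translate: "x \<in> U \<Longrightarrow> k \<in> P \<Longrightarrow> x + k \<in> U"
begin

text \<open>The uncurried form of \<open>well_adapted_family\<close> on a fixed neighborhood. In the
  joint variable, derivatives in \<open>x\<close> and in \<open>t\<close> are instances of one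
  operator \<open>dir_deriv\<close>.\<close>

definition adapted :: "('a \<times> real \<Rightarrow> 'b::euclidean_space) \<Rightarrow> bool" where
  "adapted G \<longleftrightarrow> smooth_on (U \<times> UNIV) G \<and>
    (\<forall>x\<in>U. \<forall>t. \<forall>k\<in>P. \<forall>l\<in>\<int>. G (x + k, t + l) = G (x, t))"

lemma adaptedI:
  assumes "smooth_on (U \<times> UNIV) G"
    and "\<And>x t k l. x \<in> U \<Longrightarrow> k \<in> P \<Longrightarrow> l \<in> \<int> \<Longrightarrow> G (x + k, t + l) = G (x, t)"
  shows "adapted G"
  using assms by (auto simp: adapted_def)

lemma adaptedD:
  assumes "adapted G"
  shows "smooth_on (U \<times> UNIV) G"
    and "x \<in> U \<Longrightarrow> k \<in> P \<Longrightarrow> l \<in> \<int> \<Longrightarrow> G (x + k, t + l) = G (x, t)"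
  using assms by (auto simp: adapted_def)

lemma open_dom: "open (U \<times> (UNIV :: real set))"
  using open_U by (simp add: open_Times)

lemma adapted_differentiable:
  assumes "adapted G" and "fst z \<in> U"
  shows "G differentiable at z"
  using smooth_on_differentiable[OF open_dom adaptedD(1)[OF assms(1)]] assms(2)
  by (simp add: mem_Times_iff)

text \<open>A translation has the identity as its derivative, and \<open>G\<close> agrees with its
  translate by a period on an open set around the point. Hence the derivatives at the two points
  agree.\<close>

lemma adapted_dir_deriv:
  assumes "adapted G"
  shows "adapted (dir_deriv G v)"
proof (rule adaptedI)
  show "smooth_on (U \<times> UNIV) (dir_deriv G v)"
    by (rule smooth_on_dir_deriv[OF open_dom adaptedD(1)[OF assms]])
  fix x t k and l :: real assume A: "x \<in> U" "k \<in> P" "l \<in> \<int>"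
  have "(G has_derivative (\<lambda>v. dir_deriv G v (x + k, t + l))) (at (x + k, t + l))"
    by (rule has_derivative_dir_deriv, rule adapted_differentiable[OF assms])
      (simp add: translate A)
  moreover have "((\<lambda>z. z + (k, l)) has_derivative (\<lambda>v. v)) (at (x, t))"
    by (auto intro!: derivative_eq_intros)
  ultimately have "((\<lambda>z. G (z + (k, l))) has_derivative (\<lambda>v. dir_deriv G v (x + k, t + l))) (at (x, t))"
    using has_derivative_compose[of "\<lambda>z. z + (k, l)" "\<lambda>v. v" "(x, t)" UNIV G] by simp
  then have "(G has_derivative (\<lambda>v. dir_deriv G v (x + k, t + l))) (at (x, t))"
    by (rule has_derivative_transform_within_open[OF _ open_dom])
      (use A adaptedD(2)[OF assms] in auto)
  from dir_deriv_eq[OF this] show "dir_deriv G v (x + k, t + l) = dir_deriv G v (x, t)"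
    by simp
qed

lemma adapted_diff:
  assumes "adapted G" and "adapted H"
  shows "adapted (\<lambda>z. G z - H z)"
  using assms by (auto simp: adapted_def intro: smooth_on_diff open_dom)

lemma adapted_add:
  assumes "adapted G" and "adapted H"
  shows "adapted (\<lambda>z. G z + H z)"
  using assms by (auto simp: adapted_def intro: smooth_on_add open_dom)

lemma adapted_loop:
  assumes "adapted G" and "x \<in> U"
  shows "continuous_on UNIV (\<lambda>s. G (x, s))" and "G (x, t + 1) = G (x, t)"
proof -
  show "continuous_on UNIV (\<lambda>s. G (x, s))"
    by (rule continuous_on_compose2[OF smooth_on_imp_continuous_on[OF adaptedD(1)[OF assms(1)]],
          where f = "\<lambda>s. (x, s)"])
      (use assms(2) in \<open>auto intro!: continuous_on_Pair continuous_on_const continuous_on_id\<close>)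
  show "G (x, t + 1) = G (x, t)"
    using adaptedD(2)[OF assms zero_P, of 1 t] by simp
qed

text \<open>Kept as a function of \<open>(x, t)\<close>, although constant in \<open>t\<close>, so
  that it belongs to the same class as \<open>G\<close> and can be subtracted from it.\<close>

definition mean :: "('a \<times> real \<Rightarrow> real ^ 'm::finite) \<Rightarrow> 'a \<times> real \<Rightarrow> real ^ 'm" where
  "mean G z = loop_avg (\<lambda>s. G (fst z, s))"

definition primitive :: "('a \<times> real \<Rightarrow> real ^ 'm::finite) \<Rightarrow> 'a \<times> real \<Rightarrow> real ^ 'm" where
  "primitive G z = loop_Int (\<lambda>s. G (fst z, s)) (snd z)"

lemma mean_eq_integral:
  assumes "adapted G" and "fst z \<in> U"
  shows "mean G z = integral {0..1} (\<lambda>s. G (fst z, s))"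
  unfolding mean_def by (rule loop_avg_eq_integral[OF adapted_loop(1)[OF assms]])

lemma adapted_mean:
  assumes "adapted G"
  shows "adapted (mean G)"
proof (rule adaptedI)
  have "smooth_on (U \<times> UNIV) (\<lambda>z::'a \<times> real. integral {0..1} (\<lambda>s. G (fst z, s)))"
    by (rule smooth_on_compose[OF smooth_on_integral_param[OF open_U adaptedD(1)[OF assms]] open_U
        open_dom smooth_on_linear[OF open_dom bounded_linear_fst]]) auto
  then show "smooth_on (U \<times> UNIV) (mean G)"
    by (rule smooth_on_cong[OF open_dom]) (auto simp: mean_eq_integral[OF assms])
  show "mean G (x + k, t + l) = mean G (x, t)" if "x \<in> U" "k \<in> P" for x k t and l :: real
    using adaptedD(2)[OF assms that, of 0] by (simp add: mean_def)
qed

text \<open>Differentiation under the integral. The mean ignores \<open>t\<close>, so only the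
  \<open>x\<close>-component of the direction survives.\<close>

lemma dir_deriv_mean:
  assumes "adapted G" and "fst z \<in> U"
  shows "dir_deriv (mean G) v z = mean (dir_deriv G (fst v, 0)) z"
proof -
  have "Ck_on (Suc 0) (U \<times> UNIV) G" using adaptedD(1)[OF assms(1)] by (simp add: smooth_on_def)
  from has_derivative_integral_param[OF open_U this assms(2)]
  have "((\<lambda>z. integral {0..1} (\<lambda>s. G (fst z, s))) has_derivative
      (\<lambda>v. integral {0..1} (\<lambda>s. dir_deriv G (fst v, 0) (fst z, s)))) (at z)"
    by (rule has_derivative_compose[OF has_derivative_fst[OF has_derivative_ident]])
  then have "(mean G has_derivative
      (\<lambda>v. integral {0..1} (\<lambda>s. dir_deriv G (fst v, 0) (fst z, s)))) (at z)"
    by (rule has_derivative_transform_within_open[OF _ open_dom])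
      (use assms in \<open>auto simp: mem_Times_iff mean_eq_integral\<close>)
  from dir_deriv_eq[OF this] show ?thesis
    using assms by (simp add: mean_eq_integral adapted_dir_deriv)
qed

lemma primitive_eq_scaleR:
  assumes "adapted G" and "fst z \<in> U"
  shows "primitive G z = snd z *\<^sub>R integral {0..1} (\<lambda>u. G (fst z, u * snd z) - mean G (fst z, u * snd z))"
  unfolding primitive_def
  by (subst loop_Int_eq_scaleR[OF adapted_loop(1)[OF assms]]) (simp add: mean_def)

text \<open>Supplies the integrand of \<open>primitive_eq_scaleR\<close>, with \<open>(x, t)\<close>
  as the parameter and \<open>u\<close> as the integration variable, in the form needed for
  smoothness of parameter integrals.\<close>

lemma smooth_on_reparam:
  assumes "adapted H"
  shows "smooth_on ((U \<times> UNIV) \<times> UNIV) (\<lambda>(z::'a \<times> real, u). H (fst z, u * snd z))"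
proof -
  have op: "open ((U \<times> (UNIV::real set)) \<times> (UNIV::real set))" using open_dom by (simp add: open_Times)
  note lin = bounded_linear_compose[OF bounded_linear_fst bounded_linear_fst]
    bounded_linear_compose[OF bounded_linear_snd bounded_linear_fst] bounded_linear_snd
  have "smooth_on ((U \<times> UNIV) \<times> UNIV) (\<lambda>w::('a \<times> real) \<times> real. (fst (fst w), snd w *\<^sub>R snd (fst w)))"
    by (intro smooth_on_Pair smooth_on_scaleR op lin[THEN smooth_on_linear[OF op]])
  then have "smooth_on ((U \<times> UNIV) \<times> UNIV) (\<lambda>w::('a \<times> real) \<times> real. H (fst (fst w), snd w *\<^sub>R snd (fst w)))"
    by (rule smooth_on_compose[OF adaptedD(1)[OF assms] open_dom op]) auto
  then show ?thesis by (simp add: case_prod_unfold)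
qed

lemma adapted_primitive:
  assumes "adapted G"
  shows "adapted (primitive G)"
proof (rule adaptedI)
  have "smooth_on (U \<times> UNIV) (\<lambda>z. snd z *\<^sub>R integral {0..1} (\<lambda>u. G (fst z, u * snd z) - mean G (fst z, u * snd z)))"
    using smooth_on_integral_param[OF open_dom smooth_on_reparam[OF adapted_diff[OF assms adapted_mean[OF assms]]]]
    by (intro smooth_on_scaleR[OF open_dom smooth_on_linear[OF open_dom bounded_linear_snd]]) simp
  then show "smooth_on (U \<times> UNIV) (primitive G)"
    by (rule smooth_on_cong[OF open_dom]) (auto simp: primitive_eq_scaleR[OF assms])
  show "primitive G (x + k, t + l) = primitive G (x, t)" if "x \<in> U" "k \<in> P" "l \<in> \<int>" for x k t l
    using adaptedD(2)[OF assms that(1,2), of 0]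
      loop_Int_periodic[OF adapted_loop[OF assms that(1)] that(3)]
    by (simp add: primitive_def)
qed

text \<open>The fundamental theorem of calculus on the line where \<open>x\<close> is fixed;
  uniqueness of derivatives identifies the result with the directional derivative of the joint
  map.\<close>

lemma dir_deriv_primitive_snd:
  assumes "adapted G" and "fst z \<in> U"
  shows "dir_deriv (primitive G) (0, 1) z = G z - mean G z"
proof -
  obtain x t where z: "z = (x, t)" by fastforce
  have "primitive G differentiable at (x, t)"
    using assms(2) by (intro adapted_differentiable adapted_primitive assms(1)) (simp add: z)
  from has_derivative_compose[OF has_derivative_Pair[OF has_derivative_const has_derivative_ident]
      has_derivative_dir_deriv[OF this]]
  have "((\<lambda>t. primitive G (x, t)) has_derivative (\<lambda>r. dir_deriv (primitive G) (0, r) (x, t))) (at t)" .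
  moreover have "((\<lambda>t. primitive G (x, t)) has_derivative (\<lambda>r. r *\<^sub>R (G (x, t) - mean G (x, t)))) (at t)"
    using loop_Int_has_vector_derivative[OF adapted_loop(1)[OF assms], of t]
    by (simp add: z primitive_def mean_def has_vector_derivative_def)
  ultimately have "(\<lambda>r. dir_deriv (primitive G) (0, r) (x, t)) = (\<lambda>r. r *\<^sub>R (G (x, t) - mean G (x, t)))"
    by (rule has_derivative_unique)
  from fun_cong[OF this, of 1] show ?thesis by (simp add: z)
qed

text \<open>In the rescaled integral a direction \<open>(v, 0)\<close> leaves the factor
  \<open>t\<close> and the point \<open>u * t\<close> unchanged, so only the values of
  \<open>G - mean G\<close> are differentiated. Since the mean commutes with this derivative, the
  outcome is the rescaled primitive of \<open>dir_deriv G (v, 0)\<close>.\<close>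

lemma dir_deriv_primitive_fst:
  assumes G: "adapted G" and z: "fst z \<in> U"
  shows "dir_deriv (primitive G) (v, 0) z = primitive (dir_deriv G (v, 0)) z"
proof -
  define H where "H = (\<lambda>z. G z - mean G z)"
  define H' where "H' = (\<lambda>(z::'a \<times> real, u). H (fst z, u * snd z))"
  have H: "adapted H" unfolding H_def by (intro adapted_diff adapted_mean G)
  have "Ck_on (Suc 0) ((U \<times> UNIV) \<times> UNIV) H'"
    using smooth_on_reparam[OF H] by (simp add: smooth_on_def H'_def)
  from has_derivative_integral_param[OF open_dom this, of z] z
  have "((\<lambda>z. integral {0..1} (\<lambda>u. H' (z, u))) has_derivative
      (\<lambda>w. integral {0..1} (\<lambda>u. dir_deriv H' (w, 0) (z, u)))) (at z)"
    by (simp add: mem_Times_iff)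
  then have "((\<lambda>z. snd z *\<^sub>R integral {0..1} (\<lambda>u. H' (z, u))) has_derivative
      (\<lambda>w. snd z *\<^sub>R integral {0..1} (\<lambda>u. dir_deriv H' (w, 0) (z, u))
        + snd w *\<^sub>R integral {0..1} (\<lambda>u. H' (z, u)))) (at z)"
    by (intro has_derivative_scaleR has_derivative_snd has_derivative_ident)
  then have "(primitive G has_derivative
      (\<lambda>w. snd z *\<^sub>R integral {0..1} (\<lambda>u. dir_deriv H' (w, 0) (z, u))
        + snd w *\<^sub>R integral {0..1} (\<lambda>u. H' (z, u)))) (at z)"
    by (rule has_derivative_transform_within_open[OF _ open_dom])
      (use z in \<open>auto simp: mem_Times_iff primitive_eq_scaleR[OF G] H'_def H_def\<close>)
  \<comment> \<open>The second summand of the product rule carries the factor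
    \<open>snd (v, 0) = 0\<close>.\<close>
  from dir_deriv_eq[OF this, of "(v, 0)"] have "dir_deriv (primitive G) (v, 0) z
      = snd z *\<^sub>R integral {0..1} (\<lambda>u. dir_deriv H' ((v, 0), 0) (z, u))"
    by simp
  moreover have "dir_deriv H' ((v, 0), 0) (z, u) = dir_deriv H (v, 0) (fst z, u * snd z)" for u
  proof -
    have "(H has_derivative (\<lambda>w. dir_deriv H w (fst z, u * snd z))) (at (fst z, u * snd z))"
      by (rule has_derivative_dir_deriv, rule adapted_differentiable[OF H]) (simp add: z)
    moreover have "((\<lambda>w. (fst (fst w), snd w * snd (fst w))) has_derivative
        (\<lambda>w. (fst (fst w), u * snd (fst w) + snd w * snd z))) (at (z, u))"
      by (auto intro!: derivative_eq_intros)
    ultimately have "((\<lambda>w. H (fst (fst w), snd w * snd (fst w))) has_derivative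
        (\<lambda>w. dir_deriv H (fst (fst w), u * snd (fst w) + snd w * snd z) (fst z, u * snd z))) (at (z, u))"
      using has_derivative_compose[of "\<lambda>w. (fst (fst w), snd w * snd (fst w))" _ "(z, u)" UNIV H] by simp
    from dir_deriv_eq[OF this, of "((v, 0), 0)"] show ?thesis
      by (simp add: H'_def case_prod_unfold)
  qed
  moreover have "dir_deriv H (v, 0) y = dir_deriv G (v, 0) y - mean (dir_deriv G (v, 0)) y"
    if "fst y \<in> U" for y
    unfolding H_def
    by (subst dir_deriv_eq[OF has_derivative_diff[OF
            has_derivative_dir_deriv[OF adapted_differentiable[OF G that]]
            has_derivative_dir_deriv[OF adapted_differentiable[OF adapted_mean[OF G] that]]]])
      (simp add: dir_deriv_mean[OF G that])
  ultimately show ?thesis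
    using z by (simp add: primitive_eq_scaleR adapted_dir_deriv[OF G])
qed

end


section \<open>Restriction to fast oscillations\<close>

lemma partial_eq:
  assumes "(f has_derivative f') (at x)"
  shows "partial j f x = f' (axis j 1)"
proof -
  have "((\<lambda>h. x + h *\<^sub>R axis j 1) has_derivative (\<lambda>h. h *\<^sub>R axis j 1)) (at 0)"
    by (auto intro!: derivative_eq_intros)
  from has_derivative_compose[OF this, of f f'] assms
  have "((\<lambda>h. f (x + h *\<^sub>R axis j 1)) has_derivative (\<lambda>h. h *\<^sub>R f' (axis j 1))) (at 0)"
    by (simp add: linear_scale[OF has_derivative_linear[OF assms]])
  then show ?thesis
    unfolding partial_def by (intro vector_derivative_at) (simp add: has_vector_derivative_def)
qed

lemma partial_cong:
  assumes "open U" and "x \<in> U" and "f differentiable at x" and "\<And>y. y \<in> U \<Longrightarrow> f y = g y"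
  shows "partial j f x = partial j g x"
proof -
  obtain f' where f': "(f has_derivative f') (at x)"
    using assms(3) by (auto simp: differentiable_def)
  have "(g has_derivative f') (at x)"
    by (rule has_derivative_transform_within_open[OF f' assms(1,2,4)])
  with f' show ?thesis by (simp add: partial_eq)
qed

lemma partial_eq_dir_deriv:
  assumes "f differentiable at x"
  shows "partial j f x = dir_deriv f (axis j 1) x"
  by (rule partial_eq[OF has_derivative_dir_deriv[OF assms]])

lemma partial_add_scaleR:
  fixes f g :: "real ^ 'n::finite \<Rightarrow> 'b::real_normed_vector"
  assumes "f differentiable at x" and "g differentiable at x"
  shows "partial j (\<lambda>y. f y + c *\<^sub>R g y) x = partial j f x + c *\<^sub>R partial j g x"
proof -
  obtain f' g' where d: "(f has_derivative f') (at x)" "(g has_derivative g') (at x)"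
    using assms by (auto simp: differentiable_def)
  show ?thesis
    unfolding partial_eq[OF d(1)] partial_eq[OF d(2)]
    by (rule partial_eq) (intro has_derivative_add has_derivative_scaleR_right d)
qed

text \<open>The outer derivative needs the first-order identity on a whole neighborhood of
  \<open>x\<close>; it holds on the open set \<open>U\<close> and is transferred by
  \<open>partial_cong\<close>.\<close>

lemma partial2_add_scaleR:
  fixes f g :: "real ^ 'n::finite \<Rightarrow> 'b::euclidean_space"
  assumes "open U" and "smooth_on U f" and "smooth_on U g" and "x \<in> U"
  shows "partial2 j k (\<lambda>y. f y + c *\<^sub>R g y) x = partial2 j k f x + c *\<^sub>R partial2 j k g x"
proof -
  note df = smooth_on_differentiable[OF assms(1,2)] and dg = smooth_on_differentiable[OF assms(1,3)]
  have d: "partial k u differentiable at x" if "smooth_on U u" for u :: "real ^ 'n \<Rightarrow> 'b"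
    by (rule smooth_on_differentiable[OF assms(1) smooth_on_cong[OF assms(1) smooth_on_dir_deriv[OF assms(1) that]] assms(4)])
      (simp add: partial_eq_dir_deriv smooth_on_differentiable[OF assms(1) that])
  have "smooth_on U (\<lambda>y. f y + c *\<^sub>R g y)"
    by (intro smooth_on_add smooth_on_scaleR smooth_on_const assms)
  then have "partial2 j k (\<lambda>y. f y + c *\<^sub>R g y) x = partial j (\<lambda>y. partial k f y + c *\<^sub>R partial k g y) x"
    unfolding partial2_def
    by (intro partial_cong[OF assms(1,4) d]) (auto intro: partial_add_scaleR df dg)
  then show ?thesis
    by (simp add: partial_add_scaleR d assms partial2_def)
qed

text \<open>\<open>P_int\<close> ensures that shifting \<open>x\<close> by a period shifts
  \<open>c * x $ i\<close> by an integer when \<open>c\<close> is an integer. In the application the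
  entry \<open>k $ i\<close> is 0 if \<open>i\<close> is not a periodic coordinate.\<close>

locale oscillation = periodic_domain U P for U P :: "(real ^ 'n::finite) set" +
  fixes i :: 'n
  assumes P_int: "k \<in> P \<Longrightarrow> k $ i \<in> \<int>"
begin

definition osc :: "real \<Rightarrow> ((real ^ 'n) \<times> real \<Rightarrow> 'b) \<Rightarrow> real ^ 'n \<Rightarrow> 'b" where
  "osc c G x = G (x, c * x $ i)"

abbreviation DX :: "'n \<Rightarrow> ((real ^ 'n) \<times> real \<Rightarrow> 'b::euclidean_space) \<Rightarrow> (real ^ 'n) \<times> real \<Rightarrow> 'b" where
  "DX j G \<equiv> dir_deriv G (axis j 1, 0)"

abbreviation DT :: "((real ^ 'n) \<times> real \<Rightarrow> 'b::euclidean_space) \<Rightarrow> (real ^ 'n) \<times> real \<Rightarrow> 'b" where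
  "DT G \<equiv> dir_deriv G (0, 1)"

lemma smooth_on_osc:
  assumes "adapted G"
  shows "smooth_on U (osc c G)"
proof -
  have "bounded_linear (\<lambda>x::real ^ 'n. (x, c * x $ i))"
    by (intro bounded_linear_Pair bounded_linear_ident bounded_linear_const_mult bounded_linear_vec_nth)
  from smooth_on_compose[OF adaptedD(1)[OF assms] open_dom open_U smooth_on_linear[OF open_U this]]
  show ?thesis by (simp add: osc_def[abs_def])
qed

lemma osc_differentiable:
  assumes "adapted G" and "x \<in> U"
  shows "osc c G differentiable at x"
  by (rule smooth_on_differentiable[OF open_U smooth_on_osc[OF assms(1)] assms(2)])

lemma osc_periodic:
  assumes "adapted G" and "x \<in> U" and "k \<in> P" and "c \<in> \<int>"
  shows "osc c G (x + k) = osc c G x"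
  using adaptedD(2)[OF assms(1-3) Ints_mult[OF assms(4) P_int[OF assms(3)]], of "c * x $ i"]
  by (simp add: osc_def distrib_left)

text \<open>Chain rule for the embedding of \<open>x\<close> as \<open>(x, c * x $ i)\<close>: it
  sends the direction \<open>axis j 1\<close> to \<open>(axis j 1, c)\<close> if
  \<open>j = i\<close> and to \<open>(axis j 1, 0)\<close> otherwise. This is the only source of
  factors \<open>N\<close>.\<close>

lemma partial_osc:
  assumes "adapted G" and "x \<in> U"
  shows "partial j (osc c G) x = osc c (DX j G) x + (if j = i then c else 0) *\<^sub>R osc c (DT G) x"
proof -
  have d: "G differentiable at (x, c * x $ i)"
    by (rule adapted_differentiable[OF assms(1)]) (simp add: assms(2))
  have "((\<lambda>x. (x, c * x $ i)) has_derivative (\<lambda>v. (v, c * v $ i))) (at x)"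
    by (intro bounded_linear_imp_has_derivative bounded_linear_Pair bounded_linear_ident
        bounded_linear_const_mult bounded_linear_vec_nth)
  from has_derivative_compose[OF this has_derivative_dir_deriv[OF d]]
  have "partial j (osc c G) x = dir_deriv G (axis j 1, c * axis j 1 $ i) (x, c * x $ i)"
    unfolding osc_def[abs_def] by (rule partial_eq)
  also have "(axis j 1, c * axis j 1 $ i) = (axis j 1, 0) + (if j = i then c else 0) *\<^sub>R (0, 1 :: real)"
    by (simp add: axis_def)
  also have "dir_deriv G \<dots> (x, c * x $ i)
      = osc c (DX j G) x + (if j = i then c else 0) *\<^sub>R osc c (DT G) x"
    unfolding dir_deriv_add[OF d] osc_def ..
  finally show ?thesis .
qed

text \<open>\<open>partial_osc\<close> applied twice. The two orders of mixed derivative stay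
  separate; for primitives they are evaluated by \<open>DT_DX_primitive\<close> and
  \<open>dir_deriv_DT_primitive\<close>.\<close>

lemma partial2_osc:
  fixes G :: "(real ^ 'n) \<times> real \<Rightarrow> 'b::euclidean_space"
    and c :: real
  assumes "adapted G" and "x \<in> U"
  defines "e \<equiv> \<lambda>j. if j = i then c else 0"
  shows "partial2 j k (osc c G) x
    = osc c (DX j (DX k G)) x + e j *\<^sub>R osc c (DT (DX k G)) x
      + e k *\<^sub>R (osc c (DX j (DT G)) x + e j *\<^sub>R osc c (DT (DT G)) x)"
proof -
  note D = adapted_dir_deriv[OF assms(1)]
  have "partial j (\<lambda>y. osc c (DX k G) y + e k *\<^sub>R osc c (DT G) y) x = partial j (partial k (osc c G)) x"
  proof (rule partial_cong[OF open_U assms(2)])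
    show "(\<lambda>y. osc c (DX k G) y + e k *\<^sub>R osc c (DT G) y) differentiable at x"
      by (intro differentiable_add differentiable_scaleR differentiable_const osc_differentiable D assms(2))
  qed (simp add: partial_osc[OF assms(1)] e_def)
  then have "partial2 j k (osc c G) x = partial j (osc c (DX k G)) x + e k *\<^sub>R partial j (osc c (DT G)) x"
    by (simp add: partial2_def partial_add_scaleR osc_differentiable[OF D assms(2)])
  then show ?thesis
    by (simp add: partial_osc[OF D assms(2)] e_def)
qed

section \<open>Derivatives at fixed \<open>t\<close> or fixed \<open>x\<close>, and second
  derivatives of primitives\<close>

lemma partial_slice:
  assumes "adapted G" and "x \<in> U"
  shows "partial j (\<lambda>y. G (y, t)) x = DX j G (x, t)"
proof -
  have "G differentiable at (x, t)"
    by (rule adapted_differentiable[OF assms(1)]) (simp add: assms(2))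
  from partial_eq[OF has_derivative_compose[OF has_derivative_Pair[OF has_derivative_ident
        has_derivative_const] has_derivative_dir_deriv[OF this]], of j]
  show ?thesis .
qed

lemma vector_derivative_slice:
  assumes "adapted G" and "x \<in> U"
  shows "vector_derivative (\<lambda>t. G (x, t)) (at t) = DT G (x, t)"
proof -
  have d: "G differentiable at (x, t)"
    by (rule adapted_differentiable[OF assms(1)]) (simp add: assms(2))
  from has_derivative_compose[OF has_derivative_Pair[OF has_derivative_const has_derivative_ident]
      has_derivative_dir_deriv[OF this]]
  have "((\<lambda>t. G (x, t)) has_derivative (\<lambda>r. dir_deriv G (0, r) (x, t))) (at t)" .
  moreover have "(\<lambda>r. dir_deriv G (0, r) (x, t)) = (\<lambda>r. r *\<^sub>R DT G (x, t))"
  proof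
    show "dir_deriv G (0, r) (x, t) = r *\<^sub>R DT G (x, t)" for r
      using dir_deriv_add(2)[OF d, of r "(0, 1)"]
      unfolding scaleR_Pair scaleR_zero_right real_scaleR_def mult_1_right .
  qed
  ultimately have "((\<lambda>t. G (x, t)) has_vector_derivative DT G (x, t)) (at t)"
    unfolding has_vector_derivative_def by (rule has_derivative_eq_rhs)
  then show ?thesis by (rule vector_derivative_at)
qed

lemma dir_deriv_DT_primitive:
  assumes "adapted G" and "fst z \<in> U"
  shows "dir_deriv (DT (primitive G)) v z = dir_deriv G v z - mean (dir_deriv G (fst v, 0)) z"
proof -
  note d = adapted_differentiable[OF _ assms(2)]
  have "dir_deriv (DT (primitive G)) v z = dir_deriv (\<lambda>z. G z - mean G z) v z"
    by (rule dir_deriv_cong[OF open_dom])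
      (use assms in \<open>auto intro!: d adapted_dir_deriv adapted_primitive simp: mem_Times_iff dir_deriv_primitive_snd\<close>)
  also have "\<dots> = dir_deriv G v z - dir_deriv (mean G) v z"
    by (rule dir_deriv_eq) (intro has_derivative_diff has_derivative_dir_deriv d adapted_mean assms(1))
  finally show ?thesis by (simp add: dir_deriv_mean assms)
qed

lemma DT_DT_primitive:
  assumes "adapted G" and "fst z \<in> U"
  shows "DT (DT (primitive G)) z = DT G z"
proof -
  \<comment> \<open>The direction \<open>(0, 1)\<close> has no \<open>x\<close>-component, so the
    correction from the mean is the average of a derivative in direction zero.\<close>
  have "dir_deriv G 0 (fst z, s) = 0" for s
    using dir_deriv_add(2)[OF adapted_differentiable[OF assms(1)], of "(fst z, s)" 0 0] assms(2)
    by simp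
  then have "mean (dir_deriv G (0, 0)) z = 0"
    by (simp add: mean_def loop_avg_eq_integral flip: zero_prod_def)
  then show ?thesis by (simp add: dir_deriv_DT_primitive[OF assms])
qed

text \<open>First \<open>DX j\<close> is moved inside the primitive, which is legitimate on the
  whole open domain; then the derivative in \<open>t\<close> undoes the primitive of
  \<open>DX j G\<close>.\<close>

lemma DT_DX_primitive:
  assumes "adapted G" and "fst z \<in> U"
  shows "DT (DX j (primitive G)) z = DX j G z - mean (DX j G) z"
proof -
  have "DT (DX j (primitive G)) z = DT (primitive (DX j G)) z"
    by (rule dir_deriv_cong[OF open_dom])
      (use assms in \<open>auto intro!: adapted_differentiable adapted_dir_deriv adapted_primitive
         simp: mem_Times_iff dir_deriv_primitive_fst\<close>)
  then show ?thesis by (simp add: dir_deriv_primitive_snd adapted_dir_deriv assms)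
qed

section \<open>Uniform bounds and O(1/N) remainders\<close>

lemma adapted_bounded:
  assumes "adapted G" and "compact Q" and "Q \<subseteq> U"
    and E: "\<And>x. x \<in> E \<Longrightarrow> \<exists>q\<in>Q. \<exists>k\<in>P. x = q + k"
  shows "\<exists>B. \<forall>x\<in>E. \<forall>t. norm (G (x, t)) \<le> B"
proof -
  have "compact (G ` (Q \<times> {0..1}))"
  proof (rule compact_continuous_image)
    show "continuous_on (Q \<times> {0..1}) G"
      by (rule continuous_on_subset[OF smooth_on_imp_continuous_on[OF adaptedD(1)[OF assms(1)]]])
        (use assms(3) in auto)
  qed (intro compact_Times assms(2) compact_Icc)
  then have "bounded (G ` (Q \<times> {0..1}))"
    by (rule compact_imp_bounded)
  then obtain B where B: "\<forall>y\<in>G ` (Q \<times> {0..1}). norm y \<le> B"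
    unfolding bounded_iff by blast
  have "norm (G (x, t)) \<le> B" if x: "x \<in> E" for x t
  proof -
    obtain q k where q: "q \<in> Q" "k \<in> P" "x = q + k" using E[OF x] by blast
    \<comment> \<open>Periodicity in both variables at once moves the point into the compact set
      \<open>Q\<close> times [0, 1].\<close>
    have "G (q + k, (t - of_int \<lfloor>t\<rfloor>) + of_int \<lfloor>t\<rfloor>) = G (q, t - of_int \<lfloor>t\<rfloor>)"
      by (rule adaptedD(2)[OF assms(1) subsetD[OF assms(3) q(1)] q(2) Ints_of_int])
    then have "G (x, t) = G (q, t - of_int \<lfloor>t\<rfloor>)" unfolding q(3) diff_add_cancel .
    moreover have "t - of_int \<lfloor>t\<rfloor> \<in> {0..1}" unfolding atLeastAtMost_iff by linarith
    then have "G (q, t - of_int \<lfloor>t\<rfloor>) \<in> G ` (Q \<times> {0..1})" using q(1) by blast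
    ultimately show ?thesis using B by metis
  qed
  then show ?thesis by blast
qed

lemma O_inv_uniform_osc:
  fixes a b :: "(real ^ 'n) \<times> real \<Rightarrow> 'b::euclidean_space"
  assumes "adapted a" and "adapted b" and "compact Q" and "Q \<subseteq> U"
    and E: "\<And>x. x \<in> E \<Longrightarrow> \<exists>q\<in>Q. \<exists>k\<in>P. x = q + k"
    and R: "\<And>N x. N > 0 \<Longrightarrow> x \<in> E \<Longrightarrow> R N x
      = (1 / real N) *\<^sub>R osc (real N) a x + (1 / (real N)\<^sup>2) *\<^sub>R osc (real N) b x"
  shows "O_inv_uniform E R"
proof -
  have bnd: "\<exists>B. \<forall>x\<in>E. \<forall>t. norm (G (x, t)) \<le> B" if "adapted G" for G :: "(real ^ 'n) \<times> real \<Rightarrow> 'b"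
    by (rule adapted_bounded[OF that assms(3,4)]) (rule E)
  obtain A where A: "\<And>x t. x \<in> E \<Longrightarrow> norm (a (x, t)) \<le> A"
    using bnd[OF assms(1)] by blast
  obtain B where B: "\<And>x t. x \<in> E \<Longrightarrow> norm (b (x, t)) \<le> B"
    using bnd[OF assms(2)] by blast
  \<comment> \<open>The bounds \<open>A\<close> and \<open>B\<close> add up because 1/N^2 is at most
    1/N for positive \<open>N\<close>.\<close>
  have "norm (R N x) \<le> (A + B) / real N" if "N > 0" "x \<in> E" for N x
  proof -
    have "norm (R N x) \<le> (1 / real N) * norm (osc (real N) a x) + (1 / (real N)\<^sup>2) * norm (osc (real N) b x)"
      unfolding R[OF that] by (rule order_trans[OF norm_triangle_ineq]) simp
    also have "\<dots> \<le> (1 / real N) * A + (1 / real N) * B"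
    proof (rule add_mono)
      have "norm (osc (real N) a x) \<le> A" unfolding osc_def by (rule A[OF that(2)])
      then show "(1 / real N) * norm (osc (real N) a x) \<le> (1 / real N) * A"
        by (rule mult_left_mono) simp
      have "real N \<le> (real N)\<^sup>2" using that(1) by (intro self_le_power) simp_all
      then have "1 / (real N)\<^sup>2 \<le> 1 / real N" using that(1) by (simp add: frac_le)
      moreover have "norm (osc (real N) b x) \<le> B" unfolding osc_def by (rule B[OF that(2)])
      ultimately show "(1 / (real N)\<^sup>2) * norm (osc (real N) b x) \<le> (1 / real N) * B"
        by (rule mult_mono) simp_all
    qed
    finally show ?thesis by (simp add: add_divide_distrib)
  qed
  then have "\<forall>N>0. \<forall>x\<in>E. norm (R N x) \<le> (A + B) / real N" by blast
  then show ?thesis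
    unfolding O_inv_uniform_def by (intro exI[of _ "A + B"] eventually_at_top_dense[THEN iffD2] exI[of _ 0])
qed

end

text \<open>Reduces the supremum norm claims to the same pointwise uniform remainders as the other
  expansions.\<close>

lemma O_inv_C0_norm:
  assumes "O_inv_uniform E R"
  shows "O_inv (\<lambda>N. C0_norm E (R N))"
proof -
  obtain C where "\<forall>\<^sub>F N in sequentially. \<forall>x\<in>E. norm (R N x) \<le> C / real N"
    using assms unfolding O_inv_uniform_def by blast
  then have "\<forall>\<^sub>F N in sequentially. C0_norm E (R N) \<le> ennreal (C / real N)"
    by eventually_elim (auto simp: C0_norm_def intro!: SUP_least ennreal_leI)
  then show ?thesis unfolding O_inv_def by blast
qed


section \<open>Cylinders\<close>

lemma first_proj_add_int_periods:
  "k \<in> int_periods d \<Longrightarrow> first_proj d (x + k) = first_proj d x"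
  by (auto simp: first_proj_def int_periods_def vec_eq_iff)

text \<open>\<open>first_proj d\<close> is linear, hence continuous, and takes values in
  \<open>first_space d\<close>. So the cylinder over a relatively open set is the full preimage of
  an open set of the ambient space.\<close>

lemma open_cylinder:
  assumes "openin (top_of_set (first_space d)) V"
  shows "open (cylinder d V)"
proof -
  obtain W where W: "open W" "V = first_space d \<inter> W" using assms by (auto simp: openin_open)
  have "linear (first_proj d :: (real, 'a) vec \<Rightarrow> _)"
    by (rule linearI) (auto simp: first_proj_def vec_eq_iff)
  then have "continuous_on UNIV (first_proj d :: (real, 'a) vec \<Rightarrow> _)"
    by (intro linear_continuous_on) (simp add: linear_conv_bounded_linear)
  then have "open (first_proj d -` W)" using W(1) by (simp add: continuous_on_open_vimage)
  moreover have "cylinder d V = first_proj d -` W"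
    using W(2) by (auto simp: cylinder_def first_space_def first_proj_def)
  ultimately show ?thesis by simp
qed

lemma oscillation_cylinder:
  assumes "openin (top_of_set (first_space d)) V"
  shows "oscillation (cylinder d V) (int_periods d) i"
proof unfold_locales
  show "open (cylinder d V)" by (rule open_cylinder[OF assms])
  show "0 \<in> int_periods d" by (simp add: int_periods_def)
  show "x + k \<in> cylinder d V" if "x \<in> cylinder d V" "k \<in> int_periods d" for x k
    using that by (simp add: cylinder_def first_proj_add_int_periods)
  show "k $ i \<in> \<int>" if "k \<in> int_periods d" for k
    using that by (cases "i \<in> last_coords d") (auto simp: int_periods_def)
qed

text \<open>\<open>Q\<close> is the sum of \<open>K\<close> and the closed unit cube in the last
  \<open>d\<close> coordinates. A point of the cylinder reaches it by splitting each of these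
  coordinates into fractional part and floor.\<close>

lemma cylinder_compact_representatives:
  fixes K :: "(real ^ 'n::{finite,linorder}) set"
  assumes "compact K" and "K \<subseteq> first_space d"
  obtains Q where "compact Q" and "Q \<subseteq> cylinder d K"
    and "\<And>x. x \<in> cylinder d K \<Longrightarrow> \<exists>q\<in>Q. \<exists>k\<in>int_periods d. x = q + k"
proof
  let ?C = "{x :: (real, 'n) vec. \<forall>j. x $ j \<in> (if j \<in> last_coords d then {0..1} else {0})}"
  let ?Q = "(\<lambda>(x, y). x + y) ` (K \<times> ?C)"
  have "?C = cbox 0 (\<chi> j. if j \<in> last_coords d then 1 else 0)"
    by (auto simp: mem_box_cart split: if_splits)
  then show "compact ?Q"
    by (intro compact_continuous_image compact_Times assms(1))
      (auto simp: case_prod_unfold intro!: continuous_intros compact_cbox)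
  have *: "first_proj d (x + y) = x" if "x \<in> K" "y \<in> ?C" for x y
    using that assms(2) by (auto simp: first_proj_def first_space_def vec_eq_iff split: if_splits)
  then show "?Q \<subseteq> cylinder d K" by (auto simp: cylinder_def)
  fix x :: "(real, 'n) vec" assume "x \<in> cylinder d K"
  define y :: "(real, 'n) vec" where "y = (\<chi> j. if j \<in> last_coords d then frac (x $ j) else 0)"
  define k :: "(real, 'n) vec" where "k = (\<chi> j. if j \<in> last_coords d then of_int \<lfloor>x $ j\<rfloor> else 0)"
  have "frac (x $ j) \<le> 1" for j using frac_lt_1[of "x $ j"] by linarith
  then have "y \<in> ?C" by (simp add: y_def)
  moreover have "first_proj d x \<in> K" using \<open>x \<in> cylinder d K\<close> by (simp add: cylinder_def)
  ultimately have "first_proj d x + y \<in> ?Q"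
    by (intro image_eqI[of _ _ "(first_proj d x, y)"] SigmaI) (rule prod.case[symmetric])
  moreover have "k \<in> int_periods d" by (auto simp: k_def int_periods_def)
  moreover have "x = first_proj d x + y + k"
    by (auto simp: vec_eq_iff first_proj_def y_def k_def frac_def)
  ultimately show "\<exists>q\<in>?Q. \<exists>k\<in>int_periods d. x = q + k" by blast
qed

section \<open>The expansions of \<open>F\<close> and its derivatives\<close>

theorem proposition2p2:
  fixes d :: nat
    and K E :: "(real ^ 'n::{finite,linorder}) set"
    and f :: "real ^ 'n::{finite,linorder} \<Rightarrow> real ^ 'm::finite"
    and \<gamma> \<delta> :: "real ^ 'n::{finite,linorder} \<Rightarrow> real \<Rightarrow> real ^ 'm"
    and i :: 'n
    and F :: "nat \<Rightarrow> real ^ 'n::{finite,linorder} \<Rightarrow> real ^ 'm"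
  assumes "d \<le> CARD('n)"
    and "K \<subseteq> first_space d" and "compact K"
    and "f \<in> C_per d K"
    and "well_adapted_family d K \<gamma>" and "well_adapted_family d K \<delta>"
  defines "E \<equiv> cylinder d K"
    and "F \<equiv> (\<lambda>N x. f x + (1 / real N) *\<^sub>R loop_Int (\<gamma> x) (real N * x $ i)
                    + (1 / (real N)\<^sup>2) *\<^sub>R loop_Int (loop_Int (\<delta> x)) (real N * x $ i))"
  shows
    "(\<forall>N>0. F N \<in> C_per d K) \<and>
     O_inv (\<lambda>N. C0_norm E (\<lambda>x. F N x - f x)) \<and>
     (\<forall>j. j \<noteq> i \<longrightarrow>
        O_inv (\<lambda>N. C0_norm E (\<lambda>x. partial j (F N) x - partial j f x))) \<and>
     (\<forall>j k. j \<noteq> i \<and> k \<noteq> i \<longrightarrow>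
        O_inv (\<lambda>N. C0_norm E (\<lambda>x. partial2 j k (F N) x - partial2 j k f x))) \<and>
     O_inv_uniform E (\<lambda>N x. partial i (F N) x -
           (partial i f x + \<gamma> x (real N * x $ i) - loop_avg (\<gamma> x))) \<and>
     O_inv_uniform E (\<lambda>N x. partial2 i i (F N) x -
           (partial2 i i f x
            + 2 *\<^sub>R (partial i (\<lambda>y. \<gamma> y (real N * x $ i)) x
                   - loop_avg (\<lambda>t. partial i (\<lambda>y. \<gamma> y t) x))
            + real N *\<^sub>R vector_derivative (\<gamma> x) (at (real N * x $ i))
            + \<delta> x (real N * x $ i) - loop_avg (\<delta> x))) \<and>
     (\<forall>j. j \<noteq> i \<longrightarrow>
        O_inv_uniform E (\<lambda>N x. partial2 i j (F N) x -
          (partial2 i j f x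
           + partial j (\<lambda>y. \<gamma> y (real N * x $ i)) x
           - loop_avg (\<lambda>t. partial j (\<lambda>y. \<gamma> y t) x))))"
proof -
  obtain Vf where Vf: "openin (top_of_set (first_space d)) Vf" "K \<subseteq> Vf"
      "smooth_on (cylinder d Vf) f"
      "\<And>x k. x \<in> cylinder d Vf \<Longrightarrow> k \<in> int_periods d \<Longrightarrow> f (x + k) = f x"
    using assms(4) unfolding C_per_def by blast
  obtain Vg where Vg: "openin (top_of_set (first_space d)) Vg" "K \<subseteq> Vg"
      "smooth_on (cylinder d Vg \<times> UNIV) (\<lambda>(x, t). \<gamma> x t)"
      "\<And>x k t l. x \<in> cylinder d Vg \<Longrightarrow> k \<in> int_periods d \<Longrightarrow> l \<in> \<int> \<Longrightarrow> \<gamma> (x + k) (t + l) = \<gamma> x t"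
    using assms(5) unfolding well_adapted_family_def by blast
  obtain Vh where Vh: "openin (top_of_set (first_space d)) Vh" "K \<subseteq> Vh"
      "smooth_on (cylinder d Vh \<times> UNIV) (\<lambda>(x, t). \<delta> x t)"
      "\<And>x k t l. x \<in> cylinder d Vh \<Longrightarrow> k \<in> int_periods d \<Longrightarrow> l \<in> \<int> \<Longrightarrow> \<delta> (x + k) (t + l) = \<delta> x t"
    using assms(6) unfolding well_adapted_family_def by blast
  \<comment> \<open>A common neighborhood of \<open>K\<close> on which all three chosen extensions
    are smooth and periodic.\<close>
  define V where "V = Vf \<inter> Vg \<inter> Vh"
  define U where "U = cylinder d V"
  have V: "openin (top_of_set (first_space d)) V" "K \<subseteq> V"
    using Vf Vg Vh by (auto simp: V_def)
  have U_subset: "U \<subseteq> cylinder d Vf" "U \<subseteq> cylinder d Vg" "U \<subseteq> cylinder d Vh"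
    by (auto simp: U_def V_def cylinder_def)
  interpret oscillation U "int_periods d" i
    unfolding U_def by (rule oscillation_cylinder[OF V(1)])
  define \<Gamma> where "\<Gamma> = (\<lambda>(x, t). \<gamma> x t)"
  define \<Delta> where "\<Delta> = (\<lambda>(x, t). \<delta> x t)"
  have \<Gamma>: "adapted \<Gamma>" and \<Delta>: "adapted \<Delta>"
    unfolding \<Gamma>_def \<Delta>_def
    by (rule adaptedI; use Vg Vh U_subset in \<open>auto intro: smooth_on_subset\<close>)+
  define g where "g = primitive \<Gamma>"
  define h where "h = primitive (primitive \<Delta>)"
  have g: "adapted g" and h: "adapted h"
    unfolding g_def h_def by (intro adapted_primitive \<Gamma> \<Delta>)+
  note ad = g h \<Gamma> \<Delta> adapted_dir_deriv adapted_add adapted_primitive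
  have f: "smooth_on U f" using smooth_on_subset[OF Vf(3) U_subset(1)] .
  have F: "F N = (\<lambda>x. (f x + (1 / real N) *\<^sub>R osc (real N) g x) + (1 / (real N)\<^sup>2) *\<^sub>R osc (real N) h x)"
    for N
    by (simp add: F_def osc_def g_def h_def primitive_def \<Gamma>_def \<Delta>_def)
  have EU: "E \<subseteq> U" using V(2) by (auto simp: E_def U_def cylinder_def)
  have smooth_partial_sum: "smooth_on U (\<lambda>x. f x + c *\<^sub>R osc a g x)" for a c
    by (intro smooth_on_add smooth_on_scaleR smooth_on_const f smooth_on_osc g open_U)
  obtain Q where Q: "compact Q" "Q \<subseteq> cylinder d K"
      "\<And>x. x \<in> cylinder d K \<Longrightarrow> \<exists>q\<in>Q. \<exists>k\<in>int_periods d. x = q + k"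
    using cylinder_compact_representatives[OF assms(3,2)] by blast
  \<comment> \<open>It remains, for each claim, to name the coefficients \<open>a\<close> of 1/N and
    \<open>b\<close> of 1/N^2 and to verify an exact identity for positive \<open>N\<close>.\<close>
  have O: "O_inv_uniform E R"
    if "adapted a" "adapted b" and "\<And>N x. N > 0 \<Longrightarrow> x \<in> U \<Longrightarrow> R N x
      = (1 / real N) *\<^sub>R osc (real N) a x + (1 / (real N)\<^sup>2) *\<^sub>R osc (real N) b x"
    for a b R
    using that(3) EU Q(2,3) unfolding E_def
    by (intro O_inv_uniform_osc[OF that(1,2) Q(1)]) auto
  have partial_F: "partial j (F N) x = partial j f x + (1 / real N) *\<^sub>R partial j (osc (real N) g) x
      + (1 / (real N)\<^sup>2) *\<^sub>R partial j (osc (real N) h) x" if "x \<in> U" for j N x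
    unfolding F
    by (simp add: partial_add_scaleR smooth_on_differentiable[OF open_U _ that] smooth_partial_sum
        smooth_on_osc f g h)
  have partial2_F: "partial2 j k (F N) x = partial2 j k f x
      + (1 / real N) *\<^sub>R partial2 j k (osc (real N) g) x
      + (1 / (real N)\<^sup>2) *\<^sub>R partial2 j k (osc (real N) h) x" if "x \<in> U" for j k N x
    unfolding F
    by (simp add: partial2_add_scaleR[OF open_U _ _ that] smooth_partial_sum smooth_on_osc f g h)
  \<comment> \<open>\<open>t\<close> is free here since \<open>mean\<close> does not depend on it;
    it is later set to \<open>real N * x $ i\<close> to match the point of evaluation.\<close>
  have avg: "loop_avg (\<gamma> x) = mean \<Gamma> (x, t)" "loop_avg (\<delta> x) = mean \<Delta> (x, t)" for x t
    by (simp_all add: mean_def \<Gamma>_def \<Delta>_def)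
  have partial_\<gamma>: "partial j (\<lambda>y. \<gamma> y t) x = DX j \<Gamma> (x, t)" if "x \<in> U" for j t x
    using partial_slice[OF \<Gamma> that] by (simp add: \<Gamma>_def)
  have avg_partial_\<gamma>: "loop_avg (\<lambda>t. partial j (\<lambda>y. \<gamma> y t) x) = mean (DX j \<Gamma>) (x, t)"
    if "x \<in> U" for j t x
    by (simp add: mean_def partial_\<gamma>[OF that])
  have deriv_\<gamma>: "vector_derivative (\<gamma> x) (at t) = DT \<Gamma> (x, t)" if "x \<in> U" for x t
    using vector_derivative_slice[OF \<Gamma> that] by (simp add: \<Gamma>_def)
  show ?thesis
  proof (intro conjI allI impI)
    fix N :: nat assume "N > 0"
    have "F N (x + k) = F N x" if "x \<in> U" "k \<in> int_periods d" for x k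
      using that U_subset(1) Vf(4) by (auto simp: F osc_periodic g h)
    moreover have "smooth_on U (F N)"
      unfolding F
      by (intro smooth_on_add[OF open_U smooth_partial_sum] smooth_on_scaleR smooth_on_const
          smooth_on_osc h open_U)
    ultimately show "F N \<in> C_per d K"
      unfolding C_per_def using V by (auto simp: U_def)
  next
    show "O_inv (\<lambda>N. C0_norm E (\<lambda>x. F N x - f x))"
      by (intro O_inv_C0_norm O[OF g h]) (simp add: F)
  next
    fix j assume "j \<noteq> i"
    \<comment> \<open>Away from the index \<open>i\<close> the chain rule yields no factor
      \<open>N\<close>, so the powers of 1/N in front of \<open>g\<close> and \<open>h\<close>
      persist.\<close>
    then show "O_inv (\<lambda>N. C0_norm E (\<lambda>x. partial j (F N) x - partial j f x))"
      by (intro O_inv_C0_norm O[of "DX j g" "DX j h"] ad) (simp add: partial_F partial_osc g h)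
  next
    fix j k assume "j \<noteq> i \<and> k \<noteq> i"
    then show "O_inv (\<lambda>N. C0_norm E (\<lambda>x. partial2 j k (F N) x - partial2 j k f x))"
      by (intro O_inv_C0_norm O[of "DX j (DX k g)" "DX j (DX k h)"] ad)
        (simp add: partial2_F partial2_osc g h)
  next
    show "O_inv_uniform E (\<lambda>N x. partial i (F N) x -
           (partial i f x + \<gamma> x (real N * x $ i) - loop_avg (\<gamma> x)))"
    \<comment> \<open>One factor \<open>N\<close> turns \<open>DT g\<close> / N into the oscillating
      main term and lifts \<open>DT h\<close> from order 1/N^2 to 1/N.\<close>
    proof (rule O[of "\<lambda>z. DX i g z + DT h z" "DX i h"])
      fix N :: nat and x assume N: "N > 0" and x: "x \<in> U"
      let ?z = "(x, real N * x $ i)"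
      have "DT g ?z = \<Gamma> ?z - mean \<Gamma> ?z"
        unfolding g_def by (rule dir_deriv_primitive_snd[OF \<Gamma>]) (simp add: x)
      then show "partial i (F N) x - (partial i f x + \<gamma> x (real N * x $ i) - loop_avg (\<gamma> x))
        = (1 / real N) *\<^sub>R osc (real N) (\<lambda>z. DX i g z + DT h z) x
          + (1 / (real N)\<^sup>2) *\<^sub>R osc (real N) (DX i h) x"
        using N by (simp add: partial_F partial_osc g h x osc_def avg[of x "real N * x $ i"] \<Gamma>_def
            algebra_simps power2_eq_square)
    qed (intro ad)+
  next
    show "O_inv_uniform E (\<lambda>N x. partial2 i i (F N) x -
           (partial2 i i f x
            + 2 *\<^sub>R (partial i (\<lambda>y. \<gamma> y (real N * x $ i)) x
                   - loop_avg (\<lambda>t. partial i (\<lambda>y. \<gamma> y t) x))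
            + real N *\<^sub>R vector_derivative (\<gamma> x) (at (real N * x $ i))
            + \<delta> x (real N * x $ i) - loop_avg (\<delta> x)))"
    \<comment> \<open>Two factors \<open>N\<close> are available. \<open>DT (DT g)\<close> gives the
      term of order \<open>N\<close>; the two mixed derivatives of \<open>g\<close> coincide and
      account for the coefficient 2; \<open>DT (DT h)\<close> gives the \<open>\<delta>\<close>
      term. The mixed derivatives of \<open>h\<close> fall to order 1/N.\<close>
    proof (rule O[of "\<lambda>z. DX i (DX i g) z + (DT (DX i h) z + DX i (DT h) z)" "DX i (DX i h)"])
      fix N :: nat and x assume N: "N > 0" and x: "x \<in> U"
      let ?z = "(x, real N * x $ i)"
      have "DT (DX i g) ?z = DX i \<Gamma> ?z - mean (DX i \<Gamma>) ?z"
        unfolding g_def by (rule DT_DX_primitive[OF \<Gamma>]) (simp add: x)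
      moreover have "DX i (DT g) ?z = DX i \<Gamma> ?z - mean (DX i \<Gamma>) ?z"
        unfolding g_def by (subst dir_deriv_DT_primitive[OF \<Gamma>]) (simp_all add: x)
      moreover have "DT (DT g) ?z = DT \<Gamma> ?z"
        unfolding g_def by (rule DT_DT_primitive[OF \<Gamma>]) (simp add: x)
      \<comment> \<open>With \<open>h\<close> a double primitive, the first two-fold
        \<open>t\<close>-derivative rule leaves \<open>DT (primitive \<Delta>)\<close>, and the
        fundamental theorem of calculus finishes.\<close>
      moreover have "DT (DT h) ?z = \<Delta> ?z - mean \<Delta> ?z"
        unfolding h_def using DT_DT_primitive[OF adapted_primitive[OF \<Delta>]] dir_deriv_primitive_snd[OF \<Delta>]
        by (simp add: x)
      ultimately show "partial2 i i (F N) x -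
           (partial2 i i f x
            + 2 *\<^sub>R (partial i (\<lambda>y. \<gamma> y (real N * x $ i)) x
                   - loop_avg (\<lambda>t. partial i (\<lambda>y. \<gamma> y t) x))
            + real N *\<^sub>R vector_derivative (\<gamma> x) (at (real N * x $ i))
            + \<delta> x (real N * x $ i) - loop_avg (\<delta> x))
        = (1 / real N) *\<^sub>R osc (real N) (\<lambda>z. DX i (DX i g) z + (DT (DX i h) z + DX i (DT h) z)) x
          + (1 / (real N)\<^sup>2) *\<^sub>R osc (real N) (DX i (DX i h)) x"
        unfolding avg_partial_\<gamma>[OF x, of i "real N * x $ i"] avg(2)[of x "real N * x $ i"]
        using N by (simp add: partial2_F partial2_osc g h x osc_def partial_\<gamma> deriv_\<gamma> \<Delta>_def)
          (simp add: vec_eq_iff field_simps power2_eq_square)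
    qed (intro ad)+
  next
    fix j assume j: "j \<noteq> i"
    show "O_inv_uniform E (\<lambda>N x. partial2 i j (F N) x -
          (partial2 i j f x
           + partial j (\<lambda>y. \<gamma> y (real N * x $ i)) x
           - loop_avg (\<lambda>t. partial j (\<lambda>y. \<gamma> y t) x)))"
    \<comment> \<open>Only the outer derivative in \<open>x $ i\<close> brings a factor
      \<open>N\<close>, so a single mixed term of \<open>g\<close> has order one and that of
      \<open>h\<close> has order 1/N.\<close>
    proof (rule O[of "\<lambda>z. DX i (DX j g) z + DT (DX j h) z" "DX i (DX j h)"])
      fix N :: nat and x assume N: "N > 0" and x: "x \<in> U"
      let ?z = "(x, real N * x $ i)"
      have "DT (DX j g) ?z = DX j \<Gamma> ?z - mean (DX j \<Gamma>) ?z"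
        unfolding g_def by (rule DT_DX_primitive[OF \<Gamma>]) (simp add: x)
      then show "partial2 i j (F N) x -
          (partial2 i j f x
           + partial j (\<lambda>y. \<gamma> y (real N * x $ i)) x
           - loop_avg (\<lambda>t. partial j (\<lambda>y. \<gamma> y t) x))
        = (1 / real N) *\<^sub>R osc (real N) (\<lambda>z. DX i (DX j g) z + DT (DX j h) z) x
          + (1 / (real N)\<^sup>2) *\<^sub>R osc (real N) (DX i (DX j h)) x"
        unfolding avg_partial_\<gamma>[OF x, of j "real N * x $ i"]
        using N j by (simp add: partial2_F partial2_osc g h x osc_def partial_\<gamma>
            algebra_simps power2_eq_square)
    qed (intro ad)+
  qed
qed

end
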